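(* Let $m\ge 3$ be an odd number with unique prime factorization (up to ordering) $m=p_1^{\alpha_1}p_2^{\alpha_2}\cdots p_k^{\alpha_k}$, where $p_1,\dots,p_k$ are distinct primes, and let $n$ be a positive integer. Then $G=C_m\odot\overline{K}_n$ admits at least $\left(1+\sum_{i=1}^k\alpha_i\right)(n+1)$ mutually different magic sums.
   Context: For graphs $G,H$, the corona product $G\odot H$ is obtained from one copy of $G$ and $|V(G)|$ copies of $H$ by joining each vertex of $G$ to all vertices of one copy of $H$, in such a way that all vertices in the same copy of $H$ are joined to exactly one vertex of $G$. $C_m$ is the cycle of order $m$ and $\overline{K}_n$ is the graph with $n$ vertices and no edges; so $C_m\odot\overline{K}_n$ is the cycle $C_m$ with $n$ pendant vertices attached to each cycle vertex. Let $G=(V,E)$ be a graph with $P=|V|$ vertices and $Q=|E|$ edges. An edge-magic labeling of $G$ is a bijection $f:V\cup E\to\{1,\dots,P+Q\}$ such that $f(x)+f(xy)+f(y)=s$ for every edge $xy\in E$, where $s$ is a constant called the valence or magic sum of $f$. "$G$ admits at least $N$ mutually different magic sums" means that at least $N$ distinct integers occur as magic sums of edge-magic labelings of $G$. *)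

theory Defs
  imports "HOL-Computational_Algebra.Primes"
begin

text \<open>Graphs are pairs of a vertex set and a set of edges, an edge \<open>xy\<close> being the
  two-element set \<open>{x, y}\<close>.\<close>

type_synonym 'a graph = "'a set \<times> 'a set set"

abbreviation verts :: "'a graph \<Rightarrow> 'a set" where "verts \<equiv> fst"
abbreviation edges :: "'a graph \<Rightarrow> 'a set set" where "edges \<equiv> snd"

definition simple_graph :: "'a graph \<Rightarrow> bool" where
  "simple_graph G \<longleftrightarrow> finite (verts G) \<and>
     (\<forall>e\<in>edges G. \<exists>x\<in>verts G. \<exists>y\<in>verts G. x \<noteq> y \<and> e = {x, y})"

text \<open>The order \<open>m\<close> of a cycle is at least 3; the definition is meaningless for smaller \<open>m\<close>.\<close>

definition cycle_graph :: "nat \<Rightarrow> nat graph" where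
  "cycle_graph m = ({..<m}, {{i, (i + 1) mod m} | i. i < m})"

definition edgeless_graph :: "nat \<Rightarrow> nat graph" where
  "edgeless_graph n = ({..<n}, {})"

text \<open>\<open>Inl u\<close> is the vertex \<open>u\<close> of \<open>G\<close>, and \<open>Inr (u, x)\<close> is the vertex \<open>x\<close> of the copy of \<open>H\<close>
  attached to \<open>u\<close>.\<close>

definition corona :: "'a graph \<Rightarrow> 'b graph \<Rightarrow> ('a + 'a \<times> 'b) graph" (infixl "\<odot>" 70) where
  "G \<odot> H =
    (verts G <+> (verts G \<times> verts H),
     {{Inl u, Inl v} | u v. {u, v} \<in> edges G} \<union>
     {{Inr (u, x), Inr (u, y)} | u x y. u \<in> verts G \<and> {x, y} \<in> edges H} \<union>
     {{Inl u, Inr (u, x)} | u x. u \<in> verts G \<and> x \<in> verts H})"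

text \<open>The domain \<open>V \<union> E\<close> of a labeling is the disjoint sum of the vertex set and the edge set:
  \<open>f (Inl x)\<close> labels the vertex \<open>x\<close> and \<open>f (Inr {x, y})\<close> labels the edge \<open>xy\<close>.\<close>

definition edge_magic_labeling :: "'a graph \<Rightarrow> ('a + 'a set \<Rightarrow> nat) \<Rightarrow> nat \<Rightarrow> bool" where
  "edge_magic_labeling G f s \<longleftrightarrow>
     bij_betw f (verts G <+> edges G) {1..card (verts G) + card (edges G)} \<and>
     (\<forall>x y. {x, y} \<in> edges G \<longrightarrow> f (Inl x) + f (Inr {x, y}) + f (Inl y) = s)"

definition magic_sums :: "'a graph \<Rightarrow> nat set" where
  "magic_sums G = {s. \<exists>f. edge_magic_labeling G f s}"

definition admits_magic_sums :: "'a graph \<Rightarrow> nat \<Rightarrow> bool" where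
  "admits_magic_sums G N \<longleftrightarrow> (\<exists>S. S \<subseteq> magic_sums G \<and> finite S \<and> N \<le> card S)"

lemma simple_graph_cycle:
  assumes "3 \<le> m"
  shows "simple_graph (cycle_graph m)"
proof -
  have "i \<noteq> (i + 1) mod m" "(i + 1) mod m < m" if "i < m" for i
    using assms that by (cases "i + 1 = m"; simp)+
  then show ?thesis
    unfolding simple_graph_def cycle_graph_def by fastforce
qed

lemma simple_graph_edgeless: "simple_graph (edgeless_graph n)"
  by (simp add: simple_graph_def edgeless_graph_def)

lemma simple_graph_corona:
  assumes "simple_graph G" "simple_graph H"
  shows "simple_graph (G \<odot> H)"
proof -
  have G: "u \<in> verts G \<and> v \<in> verts G \<and> u \<noteq> v" if "{u, v} \<in> edges G" for u v
    using assms(1) that unfolding simple_graph_def by (metis doubleton_eq_iff)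
  have H: "u \<in> verts H \<and> v \<in> verts H \<and> u \<noteq> v" if "{u, v} \<in> edges H" for u v
    using assms(2) that unfolding simple_graph_def by (metis doubleton_eq_iff)
  show ?thesis
    unfolding simple_graph_def
  proof (intro conjI ballI)
    show "finite (verts (G \<odot> H))"
      using assms by (simp add: simple_graph_def corona_def)
  next
    fix e assume "e \<in> edges (G \<odot> H)"
    then consider
        u v where "e = {Inl u, Inl v}" "{u, v} \<in> edges G"
      | u x y where "e = {Inr (u, x), Inr (u, y)}" "u \<in> verts G" "{x, y} \<in> edges H"
      | u x where "e = {Inl u, Inr (u, x)}" "u \<in> verts G" "x \<in> verts H"
      unfolding corona_def by auto
    then show "\<exists>x\<in>verts (G \<odot> H). \<exists>y\<in>verts (G \<odot> H). x \<noteq> y \<and> e = {x, y}"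
    proof cases
      case 1
      then show ?thesis using G[OF 1(2)]
        by (intro bexI[of _ "Inl u"] bexI[of _ "Inl v"]) (auto simp: corona_def)
    next
      case 2
      then show ?thesis using H[OF 2(3)]
        by (intro bexI[of _ "Inr (u, x)"] bexI[of _ "Inr (u, y)"]) (auto simp: corona_def)
    next
      case 3
      then show ?thesis
        by (intro bexI[of _ "Inl u"] bexI[of _ "Inr (u, x)"]) (auto simp: corona_def)
    qed
  qed
qed

end

theory Submission
  imports Defs
begin

text \<open>
  The idea is to build edge-magic labelings from the inside of the cycle to its pendant vertices,
  by writing labels in mixed radix, so that the magic equation can be checked digit by digit.
  Labels are counted from 0 until the last moment, which changes a magic sum by 3.

  The basic digit is ``half of \<open>k\<close> modulo \<open>d\<close>'', for odd \<open>d\<close>. It runs through all residues, and two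
  consecutive values add up (as integers, without reduction) to \<open>(d - 1) / 2\<close> plus the residue of
  \<open>k + 1\<close>, so that the sums fill an interval of length \<open>d\<close> exactly once (\<open>half_add_half\<close>).

  Let \<open>m = d r\<close>. A position on the cycle is \<open>k = d j + l\<close> with \<open>l < d\<close>, \<open>j < r\<close>. Give it the label
  \<open>2 r a + i\<close> where the high digit \<open>a\<close> is half of \<open>l\<close> modulo \<open>d\<close>, and the low digit \<open>i\<close> is half of
  \<open>j\<close> or of \<open>j + 1\<close> modulo \<open>r\<close>, according to the parity of \<open>l\<close>. Along one turn of \<open>l\<close> the low digit
  oscillates between these two values. It ends on the first one since \<open>d\<close> is odd, and the next turn
  starts with the second one. So every step, also that into the next turn, has a low digit sum that
  depends only on \<open>j\<close>, and the pairs of digit sums fill a \<open>d\<close> by \<open>r\<close> rectangle exactly once. Vertices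
  thus occupy every second block of \<open>r\<close> consecutive labels, and the edges can be given the blocks
  between them. The resulting magic sum \<open>3 m - 1 - (r + 1) / 2\<close> differs from divisor to divisor
  (\<open>cycle_magic_sum_of_divisor\<close>).

  Next, replace each label \<open>w\<close> of the cycle by the block \<open>(n + 1) w, \<dots>, (n + 1) w + n\<close>. A digit
  \<open>c \<le> n\<close> is reserved for all cycle vertices; the other \<open>n\<close> digits are for pendant vertices, those
  at position \<open>k\<close> being put into the block of the cycle vertex \<open>k + 1\<close>. Then each pendant edge at
  \<open>k\<close> has the same high part of its end sum as the cycle edge from \<open>k\<close> to \<open>k + 1\<close>, and these
  \<open>n + 1\<close> edges share the block of that cycle edge. The choice of \<open>c\<close> shifts the magic sum by \<open>c\<close>
  (\<open>corona_magic_sum\<close>), so that each sum of the cycle produces \<open>n + 1\<close> consecutive sums of the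
  corona, disjoint for different divisors.

  Finally, \<open>m\<close> has at least \<open>1 + \<Sum> \<alpha> i\<close> divisors: multiplying the primes one at a
  time creates a new divisor at each step (\<open>card_divisors_prod_ge\<close>).
\<close>

section \<open>Halving modulo an odd number\<close>

definition half :: "nat \<Rightarrow> nat \<Rightarrow> nat" where
  "half d k = (if even (k mod d) then (k mod d) div 2 else (k mod d + d) div 2)"

lemma half_mod [simp]: "half d (k mod d) = half d k"
  by (simp add: half_def)

lemma half_double:
  assumes "odd d" and "a < d"
  shows "half d (2 * a) = a"
proof (cases "2 * a < d")
  case True
  then show ?thesis by (simp add: half_def)
next
  case False
  then have "2 * a mod d = 2 * a - d"
    using assms by (simp add: mod_if)
  then show ?thesis
    using assms False by (simp add: half_def)
qed

text \<open>Halves of consecutive residues differ by \<open>(d + 1) / 2\<close> or by \<open>- (d - 1) / 2\<close>, and the two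
  cases alternate until the residue returns to 0; this is what keeps the integer sum within one
  interval of length \<open>d\<close>.\<close>

lemma half_add_half:
  assumes "odd d"
  shows "half d k + half d (k + 1) = (d - 1) div 2 + (k + 1) mod d"
proof (cases "Suc (k mod d) = d")
  case True
  then have "(k + 1) mod d = 0" and "k mod d = d - 1"
    by (auto simp: mod_Suc)
  then show ?thesis using assms by (simp add: half_def)
next
  case False
  then have succ: "(k + 1) mod d = k mod d + 1"
    by (simp add: mod_Suc)
  show ?thesis
    unfolding half_def succ using assms by (cases "even (k mod d)") (auto elim!: evenE oddE)
qed

section \<open>Magic sums of an odd cycle\<close>

text \<open>\<open>T\<close> is a magic sum of the cycle on the positions \<open>k < m\<close> for labels that count from 0: \<open>x k\<close>
  is the label of the vertex \<open>k\<close>, and \<open>e k\<close> that of the edge from \<open>k\<close> to its successor. There are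
  \<open>2 m\<close> labels for \<open>2 m\<close> objects, so that covering them is the same as being a bijection.\<close>

definition cycle_magic_sum :: "nat \<Rightarrow> nat \<Rightarrow> bool" where
  "cycle_magic_sum m T \<longleftrightarrow> (\<exists>x e. {..<2 * m} \<subseteq> x ` {..<m} \<union> e ` {..<m} \<and>
     (\<forall>k<m. x k + e k + x ((k + 1) mod m) = T))"

lemma cycle_magic_sum_of_divisor:
  assumes "odd d" and "odd r"
  shows "cycle_magic_sum (d * r) (3 * (d * r) - 1 - (r + 1) div 2)"
proof -
  have pos: "0 < d" "0 < r" using assms by (auto elim: oddE)
  define lo where "lo k = half r (k div d + (k mod d) mod 2)" for k
  define x where "x k = 2 * r * half d k + lo k" for k
  \<comment> \<open>Both digits of an edge label are complementary to the digit sums of its ends; the summand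
    \<open>r\<close> selects the odd blocks.\<close>
  define e where
    "e k = 2 * r * (d - 1 - (k + 1) mod d) + r + (r - 1 - (k div d + 1) mod r)" for k
  have lo_sum: "lo k + lo ((k + 1) mod (d * r)) = (r - 1) div 2 + (k div d + 1) mod r"
    if "k < d * r" for k
  proof -
    define j l where "j = k div d" and "l = k mod d"
    have lo_k: "lo k = half r (j + l mod 2)" by (simp add: lo_def j_def l_def)
    have lo_mod: "lo ((k + 1) mod (d * r)) = half r ((k + 1) div d mod r + (k + 1) mod d mod 2)"
      unfolding lo_def using pos by (simp add: mod_mult2_eq del: add_Suc_right)
    have lo_Suc: "lo ((k + 1) mod (d * r)) = half r (j + (l + 1) mod 2)"
    proof (cases "l + 1 = d")
      case True
      have div_mod: "(k + 1) div d = j + 1" "(k + 1) mod d = 0"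
        using True by (auto simp: j_def l_def div_Suc mod_Suc)
      have "lo ((k + 1) mod (d * r)) = half r ((j + 1) mod r)"
        unfolding lo_mod div_mod by simp
      \<comment> \<open>the last position of a turn is even, as \<open>d\<close> is odd\<close>
      moreover have "(l + 1) mod 2 = 1" using True assms(1) by (simp add: odd_iff_mod_2_eq_one)
      ultimately show ?thesis by simp
    next
      case False
      have div_mod: "(k + 1) div d = j" "(k + 1) mod d = l + 1"
        using False by (auto simp: j_def l_def div_Suc mod_Suc)
      have "j < r" using that pos by (simp add: j_def less_mult_imp_div_less mult.commute)
      then show ?thesis unfolding lo_mod div_mod by simp
    qed
    have "lo k + lo ((k + 1) mod (d * r)) = half r j + half r (j + 1)"
      unfolding lo_k lo_Suc by (cases "even l") (simp_all add: odd_iff_mod_2_eq_one mod_Suc)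
    then show ?thesis
      unfolding half_add_half[OF assms(2)] by (simp only: j_def)
  qed
  have hi_Suc: "half d ((k + 1) mod (d * r)) = half d (k + 1)" for k
    by (metis half_mod mod_mod_cancel dvd_triv_left)
  have magic: "x k + e k + x ((k + 1) mod (d * r)) = 3 * (d * r) - 1 - (r + 1) div 2"
    if "k < d * r" for k
  proof -
    obtain a b where ab: "d = 2 * a + 1" "r = 2 * b + 1" using assms by (auto elim!: oddE)
    define A B where "A = (k + 1) mod d" and "B = (k div d + 1) mod r"
    have bounds: "A \<le> d - 1" "B \<le> r - 1"
      using pos by (auto simp: A_def B_def less_Suc_eq_le[symmetric])
    have "x k + x ((k + 1) mod (d * r)) =
        2 * r * (half d k + half d (k + 1)) + (lo k + lo ((k + 1) mod (d * r)))"
      unfolding x_def hi_Suc by (simp add: algebra_simps)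
    also have "\<dots> = 2 * r * (a + A) + (b + B)"
      unfolding half_add_half[OF assms(1)] lo_sum[OF that] by (simp add: ab flip: A_def B_def)
        (simp add: A_def B_def ab)
    finally have "x k + e k + x ((k + 1) mod (d * r)) =
        2 * r * (a + A) + (b + B) + (2 * r * (d - 1 - A) + r + (r - 1 - B))"
      unfolding e_def A_def B_def by simp
    also have "\<dots> = 2 * r * (a + (A + (d - 1 - A))) + b + r + (B + (r - 1 - B))"
      by (simp only: algebra_simps)
    also have "\<dots> = 2 * r * (a + (d - 1)) + b + r + (r - 1)"
      using bounds by (simp only: le_add_diff_inverse)
    also have "\<dots> = 3 * (d * r) - 1 - (r + 1) div 2"
      unfolding ab by (simp add: algebra_simps)
    finally show ?thesis .
  qed
  have cover: "w \<in> x ` {..<d * r} \<union> e ` {..<d * r}" if "w < 2 * (d * r)" for w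
  proof -
    have pos_k: "d * j + l < d * r" "(d * j + l) div d = j" "(d * j + l) mod d = l"
      if "l < d" "j < r" for j l
    proof -
      have "d * j + l < d * Suc j" using that by simp
      also have "\<dots> \<le> d * r" using that by (intro mult_le_mono) auto
      finally show "d * j + l < d * r" .
    qed (use that in auto)
    define a b where "a = w div (2 * r)" and "b = w mod (2 * r)"
    have w: "w = 2 * r * a + b" by (simp add: a_def b_def)
    have a: "a < d" using that by (simp add: a_def less_mult_imp_div_less algebra_simps)
    have b: "b < 2 * r" using pos by (simp add: b_def)
    show ?thesis
    proof (cases "b < r")
      case True
      define l where "l = 2 * a mod d"
      \<comment> \<open>\<open>j\<close> solves \<open>j + l mod 2 = 2 b\<close> modulo \<open>r\<close>\<close>
      define j where "j = (2 * b + (r - l mod 2)) mod r"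
      have lj: "l < d" "j < r" using pos by (simp_all add: l_def j_def)
      have "l mod 2 \<le> r" using pos by (cases "even l") (auto simp: odd_iff_mod_2_eq_one)
      then have "(j + l mod 2) mod r = 2 * b mod r"
        by (simp add: j_def mod_add_left_eq)
      then have "half r (j + l mod 2) = b"
        by (metis half_mod half_double assms(2) True)
      moreover have "half d (d * j + l) = a"
        using half_double[OF assms(1) a] by (metis half_mod pos_k(3)[OF lj] l_def)
      ultimately have "x (d * j + l) = w"
        by (simp add: x_def lo_def pos_k[OF lj] w lj)
      then show ?thesis using pos_k(1)[OF lj] by blast
    next
      case False
      have pred: "((t + (u - 1)) mod u + 1) mod u = t mod u" if "0 < u" for t u :: nat
        using that by (simp add: mod_simps)
      define l where "l = ((d - 1 - a) + (d - 1)) mod d"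
      define j where "j = ((2 * r - 1 - b) + (r - 1)) mod r"
      have lj: "l < d" "j < r" using pos by (simp_all add: l_def j_def)
      have "(d * j + l + 1) mod d = d - 1 - a"
        using pred[of d "d - 1 - a"] a pos by (simp add: l_def add.assoc)
      moreover have "(j + 1) mod r = 2 * r - 1 - b"
        using pred[of r "2 * r - 1 - b"] b False pos by (simp add: j_def)
      ultimately have "e (d * j + l) = w"
        using a b False by (simp add: e_def pos_k[OF lj] w)
      then show ?thesis using pos_k(1)[OF lj] by blast
    qed
  qed
  show ?thesis
    unfolding cycle_magic_sum_def using magic cover by blast
qed

section \<open>Magic sums of the corona\<close>

lemma verts_corona_cycle:
  "verts (cycle_graph m \<odot> edgeless_graph n) = {..<m} <+> ({..<m} \<times> {..<n})"
  by (simp add: corona_def cycle_graph_def edgeless_graph_def)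

lemma edges_corona_cycle:
  "edges (cycle_graph m \<odot> edgeless_graph n) =
     (\<lambda>k. {Inl k, Inl ((k + 1) mod m)}) ` {..<m} \<union>
     (\<lambda>(k, y). {Inl k, Inr (k, y)}) ` ({..<m} \<times> {..<n})"
proof -
  have "{{Inl u, Inl v} | u v. {u, v} \<in> edges (cycle_graph m)} =
      (\<lambda>k. {Inl k, Inl ((k + 1) mod m)} :: (nat + nat \<times> nat) set) ` {..<m}"
    unfolding cycle_graph_def by (auto simp: doubleton_eq_iff)
  then show ?thesis
    by (auto simp: corona_def cycle_graph_def edgeless_graph_def)
qed

text \<open>A covering of \<open>{1..2 P}\<close> by labels of a graph with \<open>P\<close> vertices and at most \<open>P\<close> edges must be
  a bijection. An edge label is forced by the labels of its ends, hence it suffices to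
  provide the labels of the vertices and to check that all numbers are covered.\<close>

lemma magic_sum_if_cover:
  fixes G :: "'a graph" and v :: "'a \<Rightarrow> nat"
  assumes simple: "simple_graph G"
    and few_edges: "card (edges G) \<le> card (verts G)" and fin: "finite (edges G)"
    and sums: "\<And>x y. {x, y} \<in> edges G \<Longrightarrow> v x + v y \<le> s"
    and cover: "{1..2 * card (verts G)} \<subseteq> v ` verts G \<union> (\<lambda>e. s - sum v e) ` edges G"
  shows "s \<in> magic_sums G"
proof -
  define f where "f = case_sum v (\<lambda>e. s - sum v e)"
  let ?D = "verts G <+> edges G"
  have finV: "finite (verts G)" using simple by (simp add: simple_graph_def)
  have finD: "finite ?D" using finV fin by simp
  have cardD: "card ?D = card (verts G) + card (edges G)"
    using finV fin by (simp add: card_Plus)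
  have img: "f ` ?D = v ` verts G \<union> (\<lambda>e. s - sum v e) ` edges G"
    by (simp add: f_def Plus_def image_Un image_image)
  have "card (f ` ?D) \<le> card ?D" by (rule card_image_le[OF finD])
  then have le: "card (f ` ?D) \<le> 2 * card (verts G)" using cardD few_edges by simp
  have eq: "{1..2 * card (verts G)} = f ` ?D"
    using le finD cover img by (intro card_seteq) auto
  have "2 * card (verts G) = card (f ` ?D)" by (simp flip: eq)
  then have card_eq: "card (f ` ?D) = card ?D" "card (edges G) = card (verts G)"
    using card_image_le[OF finD, of f] cardD few_edges by linarith+
  have "bij_betw f ?D {1..card (verts G) + card (edges G)}"
    unfolding bij_betw_def using eq_card_imp_inj_on[OF finD card_eq(1)] eq card_eq(2)
    by (simp add: mult_2)
  moreover have "f (Inl x) + f (Inr {x, y}) + f (Inl y) = s" if "{x, y} \<in> edges G" for x y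
  proof -
    have "x \<noteq> y" using simple that unfolding simple_graph_def by fastforce
    then show ?thesis using sums[OF that] by (simp add: f_def)
  qed
  ultimately show ?thesis
    unfolding magic_sums_def edge_magic_labeling_def by blast
qed

lemma corona_magic_sum:
  assumes m: "3 \<le> m" and T: "cycle_magic_sum m T" and c: "c \<le> n"
  shows "(n + 1) * T + n + c + 3 \<in> magic_sums (cycle_graph m \<odot> edgeless_graph n)"
    (is "?s \<in> magic_sums ?G")
proof -
  obtain x e where cover: "{..<2 * m} \<subseteq> x ` {..<m} \<union> e ` {..<m}"
    and magic: "\<And>k. k < m \<Longrightarrow> x k + e k + x ((k + 1) mod m) = T"
    using T unfolding cycle_magic_sum_def by blast
  \<comment> \<open>the increasing enumeration of the digits other than \<open>c\<close>\<close>
  define place where "place y = (if y < c then y else y + 1)" for y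
  have place_le: "place y \<le> n" if "y < n" for y using that by (simp add: place_def)
  have place_surj: "\<exists>y<n. place y = z" if "z \<le> n" "z \<noteq> c" for z
  proof (cases "z < c")
    case True
    then show ?thesis using c by (intro exI[of _ z]) (simp add: place_def)
  next
    case False
    then show ?thesis using that by (intro exI[of _ "z - 1"]) (auto simp: place_def)
  qed
  define v where "v = case_sum (\<lambda>k. (n + 1) * x k + c + 1)
    (\<lambda>(k, y). (n + 1) * x ((k + 1) mod m) + place y + 1)"
  have vC: "v (Inl k) = (n + 1) * x k + c + 1" for k by (simp add: v_def)
  have vP: "v (Inr (k, y)) = (n + 1) * x ((k + 1) mod m) + place y + 1" for k y
    by (simp add: v_def)
  have s_eq: "?s = (n + 1) * x k + c + 1 + ((n + 1) * e k + n + 1) +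
      ((n + 1) * x ((k + 1) mod m) + 1)" if "k < m" for k
    unfolding magic[OF that, symmetric] by (simp add: algebra_simps)
  have sum_C: "v (Inl k) + v (Inl ((k + 1) mod m)) + ((n + 1) * e k + (n - c) + 1) = ?s"
    if "k < m" for k
    unfolding vC s_eq[OF that] using c by simp
  have sum_P: "v (Inl k) + v (Inr (k, y)) + ((n + 1) * e k + (n - place y) + 1) = ?s"
    if "k < m" "y < n" for k y
    unfolding vC vP s_eq[OF that(1)] using place_le[OF that(2)] by simp
  have distinct: "k \<noteq> (k + 1) mod m" if "k < m" for k
    using m that by (cases "k + 1 = m") auto
  have card_V: "card (verts ?G) = m * (n + 1)"
    by (simp add: verts_corona_cycle card_Plus)
  show ?thesis
  proof (rule magic_sum_if_cover)
    show "simple_graph ?G"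
      using m by (intro simple_graph_corona simple_graph_cycle simple_graph_edgeless)
    show "finite (edges ?G)" by (simp add: edges_corona_cycle)
    have "card (edges ?G) \<le> m + m * n"
      unfolding edges_corona_cycle
      by (intro order.trans[OF card_Un_le] add_mono order.trans[OF card_image_le]) auto
    then show "card (edges ?G) \<le> card (verts ?G)" by (simp add: card_V)
    show "v a + v b \<le> ?s" if ab: "{a, b} \<in> edges ?G" for a b
    proof -
      from ab show ?thesis
        unfolding edges_corona_cycle
      proof (elim UnE imageE)
        fix k assume "{a, b} = {Inl k, Inl ((k + 1) mod m)}" and "k \<in> {..<m}"
        then show ?thesis using sum_C[of k] by (auto simp: doubleton_eq_iff)
      next
        fix ky assume "{a, b} = (\<lambda>(k, y). {Inl k, Inr (k, y)}) ky"
          and "ky \<in> {..<m} \<times> {..<n}"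
        then show ?thesis
          using sum_P[of "fst ky" "snd ky"] by (auto simp: doubleton_eq_iff split_beta)
      qed
    qed
    show "{1..2 * card (verts ?G)} \<subseteq> v ` verts ?G \<union> (\<lambda>e. ?s - sum v e) ` edges ?G"
    proof
      fix L assume L: "L \<in> {1..2 * card (verts ?G)}"
      define w z where "w = (L - 1) div (n + 1)" and "z = (L - 1) mod (n + 1)"
      have L_eq: "L = (n + 1) * w + z + 1"
        using L unfolding w_def z_def by (simp del: add_Suc_right)
      have z: "z \<le> n" by (simp add: z_def less_Suc_eq_le[symmetric])
      have "L - 1 < 2 * m * (n + 1)" using L unfolding card_V by (simp only: atLeastAtMost_iff mult.assoc) linarith
      then have "w < 2 * m" unfolding w_def by (rule less_mult_imp_div_less)
      then consider k where "k < m" "w = x k" | k where "k < m" "w = e k"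
        using cover by blast
      then show "L \<in> v ` verts ?G \<union> (\<lambda>e. ?s - sum v e) ` edges ?G"
      proof cases
        case 1
        show ?thesis
        proof (cases "z = c")
          case True
          have "Inl k \<in> verts ?G" using 1 by (auto simp: verts_corona_cycle)
          moreover have "L = v (Inl k)" using True 1 by (simp add: vC L_eq)
          ultimately show ?thesis by blast
        next
          case False
          then obtain y where y: "y < n" "place y = z" using place_surj z by blast
          \<comment> \<open>the block of \<open>x k\<close> belongs to the pendant vertices of the predecessor of \<open>k\<close>\<close>
          define k' where "k' = (k + (m - 1)) mod m"
          have k': "k' < m" "(k' + 1) mod m = k"
            using 1 m by (auto simp: k'_def mod_Suc_eq)
          have "Inr (k', y) \<in> verts ?G" using k' y by (auto simp: verts_corona_cycle)
          moreover have "L = v (Inr (k', y))" unfolding vP k' using 1 y by (simp add: L_eq)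
          ultimately show ?thesis by blast
        qed
      next
        case 2
        show ?thesis
        proof (cases "n - z = c")
          case True
          let ?e = "{Inl k, Inl ((k + 1) mod m)}"
          have "?e \<in> edges ?G" using 2 by (auto simp: edges_corona_cycle)
          moreover have "sum v ?e = v (Inl k) + v (Inl ((k + 1) mod m))"
            using distinct[OF 2(1)] by simp
          moreover have "L = (n + 1) * e k + (n - c) + 1"
            using True z 2 by (auto simp: L_eq)
          ultimately have "L = ?s - sum v ?e" "?e \<in> edges ?G"
            using sum_C[OF 2(1)] by simp_all
          then show ?thesis by blast
        next
          case False
          then obtain y where y: "y < n" "place y = n - z"
            using place_surj[of "n - z"] by auto
          let ?e = "{Inl k, Inr (k, y)}"
          have "?e \<in> edges ?G" using 2 y by (auto simp: edges_corona_cycle)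
          moreover have "sum v ?e = v (Inl k) + v (Inr (k, y))" by simp
          moreover have "L = (n + 1) * e k + (n - place y) + 1"
            using y z 2 by (auto simp: L_eq)
          ultimately have "L = ?s - sum v ?e" "?e \<in> edges ?G"
            using sum_P[OF 2(1) y(1)] by simp_all
          then show ?thesis by blast
        qed
      qed
    qed
  qed
qed

section \<open>Counting divisors\<close>

lemma card_divisors_mult_gt:
  fixes a p :: nat
  assumes "0 < a" and "1 < p"
  shows "card {t. t dvd a} + 1 \<le> card {t. t dvd a * p}"
proof -
  have "\<not> a * p dvd a" using assms by (auto dest: dvd_imp_le)
  then have "card {t. t dvd a} + 1 = card (insert (a * p) {t. t dvd a})"
    using assms by simp
  also have "\<dots> \<le> card {t. t dvd a * p}"
    using assms by (intro card_mono) auto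
  finally show ?thesis .
qed

lemma card_divisors_prod_ge:
  fixes p \<alpha> :: "'i \<Rightarrow> nat"
  assumes "finite I" and "\<And>i. i \<in> I \<Longrightarrow> 1 < p i"
  shows "1 + (\<Sum>i\<in>I. \<alpha> i) \<le> card {t. t dvd (\<Prod>i\<in>I. p i ^ \<alpha> i)}"
  using assms
proof (induction I)
  case empty
  then show ?case by simp
next
  case (insert i I)
  define a where "a = (\<Prod>i\<in>I. p i ^ \<alpha> i)"
  have a: "0 < a" unfolding a_def using insert.prems by (intro prod_pos) fastforce
  have p: "1 < p i" using insert.prems by simp
  have "card {t. t dvd a} + b \<le> card {t. t dvd a * p i ^ b}" for b
  proof (induction b)
    case (Suc b)
    then show ?case
      using card_divisors_mult_gt[of "a * p i ^ b" "p i"] a p by (simp add: ac_simps)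
  qed simp
  from this[of "\<alpha> i"] show ?case
    using insert by (simp add: a_def mult.commute)
qed

section \<open>Distinct magic sums from distinct divisors\<close>

theorem theorem4p5:
  fixes m n k :: nat and p \<alpha> :: "nat \<Rightarrow> nat"
  assumes "3 \<le> m" and "odd m"
    and "\<forall>i\<in>{1..k}. prime (p i)" and "inj_on p {1..k}"
    and "\<forall>i\<in>{1..k}. 1 \<le> \<alpha> i"
    and "m = (\<Prod>i=1..k. p i ^ \<alpha> i)"
    and "1 \<le> n"
  shows "admits_magic_sums (cycle_graph m \<odot> edgeless_graph n) ((1 + (\<Sum>i=1..k. \<alpha> i)) * (n + 1))"
proof -
  let ?D = "{r. r dvd m} \<times> {..n}"
  define T where "T r = 3 * m - 1 - (r + 1) div 2" for r
  define s where "s = (\<lambda>(r, c). (n + 1) * T r + n + c + 3)"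
  have fin: "finite ?D" using assms(1) by simp
  have "s ` ?D \<subseteq> magic_sums (cycle_graph m \<odot> edgeless_graph n)"
  proof -
    have "cycle_magic_sum m (T r)" if r: "r dvd m" for r
    proof -
      obtain d where "m = r * d" using r by (rule dvdE)
      then show ?thesis
        using cycle_magic_sum_of_divisor[of d r] assms(2) by (simp add: T_def mult.commute)
    qed
    then show ?thesis
      using corona_magic_sum[OF assms(1)] by (auto simp: s_def)
  qed
  moreover have "inj_on s ?D"
  proof (rule inj_onI)
    fix u u' assume u: "u \<in> ?D" "u' \<in> ?D" and s: "s u = s u'"
    obtain r c r' c' where pairs: "u = (r, c)" "u' = (r', c')" by (metis surj_pair)
    have r: "r dvd m" "r' dvd m" and c: "c \<le> n" "c' \<le> n" using u by (auto simp: pairs)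
    from s pairs have eq: "(n + 1) * T r + c = (n + 1) * T r' + c'" by (simp add: s_def)
    have "((n + 1) * t + u) div (n + 1) = t" if "u \<le> n" for t u
      using that by (intro div_nat_eqI) auto
    with eq c have T: "T r = T r'" by metis
    \<comment> \<open>the truncated subtractions in \<open>T\<close> are exact, and divisors of \<open>m\<close> are odd\<close>
    have "odd r" "odd r'" using r assms(2) by (auto elim: dvd_trans)
    then obtain a b where ab: "r = 2 * a + 1" "r' = 2 * b + 1" by (auto elim!: oddE)
    have "r \<le> m" "r' \<le> m" using r assms(1) by (auto intro: dvd_imp_le)
    then have "r = r'" using T assms(1) unfolding T_def ab by simp
    with eq show "u = u'" by (simp add: pairs)
  qed
  then have "card (s ` ?D) = card {r. r dvd m} * (n + 1)"
    by (simp add: card_image card_cartesian_product)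
  moreover have "1 + (\<Sum>i=1..k. \<alpha> i) \<le> card {r. r dvd m}"
    unfolding assms(6) using assms(3)
    by (intro card_divisors_prod_ge) (blast intro: prime_gt_1_nat)+
  ultimately show ?thesis
    unfolding admits_magic_sums_def using fin
    by (intro exI[of _ "s ` ?D"] conjI finite_imageI) (simp_all only: mult_le_mono1)
qed

end
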